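(* Let $G=(V,E)$ be a finite connected loopless graph. The face poset of the Voronoi cell $\mathrm{Vor}_F(O)$ (the set of its faces ordered by inclusion) is isomorphic to the poset $\mathcal{CAC}$ of coherent acyclic orientations of cut subgraphs of $G$.
   Context: $\mathbb{E}$: oriented edges of $G$. $C^0(G,A)$ = functions $V\to A$; $C^1(G,A)$ = antisymmetric functions $x\colon\mathbb{E}\to A$ ($x_{\bar e}=-x_e$); $d(f)(uv)=f(v)-f(u)$; $F_\mathbb{R}=d(C^0(G,\mathbb{R}))$, $F_\mathbb{Z}=d(C^0(G,\mathbb{Z}))$ (the cut lattice). Inner product $\langle x,y\rangle=\sum_{e\in E}x_ey_e$ (each edge once), norm $\|\cdot\|$. $\mathrm{Vor}_F(O)=\{x\in F_\mathbb{R}:\|x\|\le\|x-\alpha\|\ \forall\alpha\in F_\mathbb{Z}\}$. A spanning subgraph $G'$ of $G$ is a cut subgraph if there is a partition $V_1,\dots,V_s$ of $V$ such that $E(G')$ consists of all edges of $G$ joining vertices in different parts. An orientation $D$ of a subgraph of $G$ is coherent acyclic if there is a partition $V_1,\dots,V_s$ of $V$ such that $D$ orients exactly the edges of $G$ joining different parts, each edge between $V_i$ and $V_j$ with $i<j$ being oriented from $V_i$ to $V_j$. Viewing such $D$ as its set $\mathbb{E}(D)\subseteq\mathbb{E}$ of oriented edges, $\mathcal{CAC}$ is the set of all of them, with $D_1\preceq D_2$ iff $\mathbb{E}(D_2)\subseteq\mathbb{E}(D_1)$. *)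

theory Defs
  imports
    "HOL-Analysis.Analysis"
    "HOL-Library.Disjoint_Sets"
    "Graph_Theory.Digraph_Component"
    "Graph_Theory.Bidirected_Digraph"
begin

text \<open>
  An undirected graph, possibly with parallel edges, is a bidirected digraph \<open>G\<close>: the arcs are
  the oriented edges and the fixed-point-free involution \<open>rv\<close> on the arcs is orientation
  reversal. An edge is a pair \<open>{e, rv e}\<close>. The arcs are an arbitrary subset of a finite type, so
  that 1-cochains live in the library's Euclidean space; their coordinates off the arcs are 0.
\<close>

definition edges :: "('a, 'b) pre_digraph \<Rightarrow> ('b \<Rightarrow> 'b) \<Rightarrow> 'b set set" where
  "edges G rv = (\<lambda>e. {e, rv e}) ` arcs G"

text \<open>The coefficient groups are subgroups \<open>A\<close> of the reals, here \<open>UNIV\<close> and \<open>\<int>\<close>.\<close>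

definition C0 :: "('a, 'b) pre_digraph \<Rightarrow> real set \<Rightarrow> ('a \<Rightarrow> real) set" where
  "C0 G A = verts G \<rightarrow>\<^sub>E A"

definition C1 :: "('a, 'b::finite) pre_digraph \<Rightarrow> ('b \<Rightarrow> 'b) \<Rightarrow> real set \<Rightarrow> (real ^ 'b) set" where
  "C1 G rv A = {x. (\<forall>e\<in>arcs G. x $ e \<in> A \<and> x $ rv e = - (x $ e)) \<and> (\<forall>e. e \<notin> arcs G \<longrightarrow> x $ e = 0)}"

definition coboundary :: "('a, 'b::finite) pre_digraph \<Rightarrow> ('a \<Rightarrow> real) \<Rightarrow> real ^ 'b" where
  "coboundary G f = (\<chi> e. if e \<in> arcs G then f (head G e) - f (tail G e) else 0)"

definition cut_space :: "('a, 'b::finite) pre_digraph \<Rightarrow> (real ^ 'b) set" where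
  "cut_space G = coboundary G ` C0 G UNIV"

definition cut_lattice :: "('a, 'b::finite) pre_digraph \<Rightarrow> (real ^ 'b) set" where
  "cut_lattice G = coboundary G ` C0 G \<int>"

text \<open>
  The sum takes each edge once. For 1-cochains the summand does not depend on the orientation
  chosen. The library inner product on \<open>real ^ 'b\<close> is twice this one.
\<close>

definition edge_inner ::
  "('a, 'b::finite) pre_digraph \<Rightarrow> ('b \<Rightarrow> 'b) \<Rightarrow> real ^ 'b \<Rightarrow> real ^ 'b \<Rightarrow> real" where
  "edge_inner G rv x y = (\<Sum>p\<in>edges G rv. let e = (SOME e. e \<in> p) in x $ e * y $ e)"

definition edge_norm :: "('a, 'b::finite) pre_digraph \<Rightarrow> ('b \<Rightarrow> 'b) \<Rightarrow> real ^ 'b \<Rightarrow> real" where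
  "edge_norm G rv x = sqrt (edge_inner G rv x x)"

definition voronoi_cell :: "('a, 'b::finite) pre_digraph \<Rightarrow> ('b \<Rightarrow> 'b) \<Rightarrow> (real ^ 'b) set" where
  "voronoi_cell G rv =
     {x \<in> cut_space G. \<forall>\<alpha>\<in>cut_lattice G. edge_norm G rv x \<le> edge_norm G rv (x - \<alpha>)}"

text \<open>
  The empty set, which is a face in the library's sense, is not counted: \<open>CAC\<close> below
  has in general no least element, its minimal elements corresponding to the vertices of the cell.
\<close>

definition faces :: "'v::real_vector set \<Rightarrow> 'v set set" where
  "faces P = {F. F face_of P \<and> F \<noteq> {}}"

definition cut_subgraph :: "('a, 'b) pre_digraph \<Rightarrow> ('a, 'b) pre_digraph \<Rightarrow> bool" where
  "cut_subgraph H G \<longleftrightarrow> spanning H G \<and>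
     (\<exists>P. partition_on (verts G) P \<and>
       arcs H = {e \<in> arcs G. \<exists>U\<in>P. \<exists>W\<in>P. U \<noteq> W \<and> tail G e \<in> U \<and> head G e \<in> W})"

definition orientation_of :: "'b set \<Rightarrow> ('a, 'b) pre_digraph \<Rightarrow> ('b \<Rightarrow> 'b) \<Rightarrow> bool" where
  "orientation_of D H rv \<longleftrightarrow> D \<subseteq> arcs H \<and> (\<forall>e\<in>arcs H. e \<in> D \<longleftrightarrow> rv e \<notin> D)"

definition coherent_acyclic :: "('a, 'b) pre_digraph \<Rightarrow> 'b set \<Rightarrow> bool" where
  "coherent_acyclic G D \<longleftrightarrow>
     (\<exists>Vs. distinct Vs \<and> partition_on (verts G) (set Vs) \<and>
       D = {e \<in> arcs G. \<exists>i j. i < j \<and> j < length Vs \<and> tail G e \<in> Vs ! i \<and> head G e \<in> Vs ! j})"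

definition CAC :: "('a, 'b) pre_digraph \<Rightarrow> ('b \<Rightarrow> 'b) \<Rightarrow> 'b set set" where
  "CAC G rv = {D. coherent_acyclic G D \<and> (\<exists>H. cut_subgraph H G \<and> orientation_of D H rv)}"

definition CAC_le :: "'b set \<Rightarrow> 'b set \<Rightarrow> bool" where
  "CAC_le D1 D2 \<longleftrightarrow> D2 \<subseteq> D1"

definition poset_isomorphic ::
  "'p set \<Rightarrow> ('p \<Rightarrow> 'p \<Rightarrow> bool) \<Rightarrow> 'q set \<Rightarrow> ('q \<Rightarrow> 'q \<Rightarrow> bool) \<Rightarrow> bool" where
  "poset_isomorphic A le_A B le_B \<longleftrightarrow>
     (\<exists>\<phi>. bij_betw \<phi> A B \<and> (\<forall>x\<in>A. \<forall>y\<in>A. le_A x y \<longleftrightarrow> le_B (\<phi> x) (\<phi> y)))"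

lemma coboundary_in_C1:
  assumes "bidirected_digraph G rv"
  shows "coboundary G f \<in> C1 G rv UNIV"
proof -
  interpret bidirected_digraph G rv by (rule assms)
  show ?thesis by (auto simp: C1_def coboundary_def)
qed

lemma coboundary_in_C1_Ints:
  assumes "bidirected_digraph G rv" "f \<in> C0 G \<int>"
  shows "coboundary G f \<in> C1 G rv \<int>"
proof -
  interpret bidirected_digraph G rv by (rule assms)
  show ?thesis
    using assms(2) by (auto simp: C0_def C1_def coboundary_def PiE_def Pi_def intro!: Ints_diff)
qed

lemma edge_inner_eq_sum_orientation:
  fixes G :: "('a, 'b::finite) pre_digraph"
  assumes G: "bidirected_digraph G arev"
    and x: "x \<in> C1 G arev UNIV" and y: "y \<in> C1 G arev UNIV" and D: "orientation_of D G arev"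
  shows "edge_inner G arev x y = (\<Sum>e\<in>D. x $ e * y $ e)"
proof -
  interpret bidirected_digraph G arev by (rule G)
  have sub: "D \<subseteq> arcs G" and one: "\<And>e. e \<in> arcs G \<Longrightarrow> e \<in> D \<longleftrightarrow> arev e \<notin> D"
    using D unfolding orientation_of_def by blast+
  have inj: "inj_on (\<lambda>e. {e, arev e}) D"
    using sub one unfolding inj_on_def doubleton_eq_iff by blast
  have "edges G arev = (\<lambda>e. {e, arev e}) ` D"
  proof (intro equalityI subsetI)
    fix p assume "p \<in> edges G arev"
    then obtain e where e: "e \<in> arcs G" "p = {e, arev e}"
      by (auto simp: edges_def)
    show "p \<in> (\<lambda>e. {e, arev e}) ` D"
    proof (cases "e \<in> D")
      case False
      then have "arev e \<in> D" using one e by blast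
      moreover have "p = {arev e, arev (arev e)}" using e by auto
      ultimately show ?thesis by blast
    qed (use e in blast)
  qed (use sub in \<open>auto simp: edges_def\<close>)
  then have "edge_inner G arev x y =
      (\<Sum>e\<in>D. let a = (SOME a. a \<in> {e, arev e}) in x $ a * y $ a)"
    unfolding edge_inner_def by (simp add: sum.reindex[OF inj])
  also have "\<dots> = (\<Sum>e\<in>D. x $ e * y $ e)"
  proof (rule sum.cong[OF refl])
    fix e assume "e \<in> D"
    then have e: "e \<in> arcs G" using sub by auto
    have "(SOME a. a \<in> {e, arev e}) \<in> {e, arev e}" by (rule someI[of _ e]) simp
    then show "(let a = (SOME a. a \<in> {e, arev e}) in x $ a * y $ a) = x $ e * y $ e"
      using x y e by (auto simp: Let_def C1_def)
  qed
  finally show ?thesis .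
qed

lemma (in bidirected_digraph) coherent_acyclic_orients_cut_subgraph:
  assumes "coherent_acyclic G D"
  shows "\<exists>H. cut_subgraph H G \<and> orientation_of D H arev"
proof -
  obtain Vs where d: "distinct Vs" and p: "partition_on (verts G) (set Vs)"
    and D: "D = {e \<in> arcs G. \<exists>i j. i < j \<and> j < length Vs \<and> tail G e \<in> Vs ! i \<and> head G e \<in> Vs ! j}"
    using assms by (auto simp: coherent_acyclic_def)
  have uniq: "i = j" if "v \<in> Vs ! i" "v \<in> Vs ! j" "i < length Vs" "j < length Vs" for v i j
  proof -
    have "Vs ! i = Vs ! j"
      using that p nth_mem[of i Vs] nth_mem[of j Vs]
      unfolding partition_on_def disjoint_def by blast
    then show ?thesis using d that by (simp add: nth_eq_iff_index_eq)
  qed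
  define B where
    "B = {e \<in> arcs G. \<exists>U\<in>set Vs. \<exists>W\<in>set Vs. U \<noteq> W \<and> tail G e \<in> U \<and> head G e \<in> W}"
  define H where "H = G\<lparr>arcs := B\<rparr>"
  have H: "verts H = verts G" "arcs H = B" "tail H = tail G" "head H = head G"
    by (simp_all add: H_def)
  have B: "e \<in> B \<longleftrightarrow> e \<in> arcs G \<and>
      (\<exists>i<length Vs. \<exists>j<length Vs. i \<noteq> j \<and> tail G e \<in> Vs ! i \<and> head G e \<in> Vs ! j)" for e
  proof -
    have bex: "(\<exists>U\<in>set Vs. Q U) \<longleftrightarrow> (\<exists>i<length Vs. Q (Vs ! i))" for Q
      by (metis in_set_conv_nth)
    show ?thesis
      unfolding B_def mem_Collect_eq bex using nth_eq_iff_index_eq[OF d] by blast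
  qed
  have "wf_digraph H"
    by unfold_locales (auto simp: H B_def)
  then have "cut_subgraph H G"
    using p by (auto simp: cut_subgraph_def spanning_def subgraph_def compatible_def H B_def wf_digraph_axioms)
  moreover have "orientation_of D H arev"
    unfolding orientation_of_def
  proof (intro conjI ballI)
    show "D \<subseteq> arcs H"
    proof
      fix e assume "e \<in> D"
      then obtain k l where "e \<in> arcs G" "k < l" "l < length Vs" "tail G e \<in> Vs ! k" "head G e \<in> Vs ! l"
        unfolding D by blast
      then have "e \<in> B" unfolding B by (metis less_trans less_irrefl)
      then show "e \<in> arcs H" by (simp add: H)
    qed
  next
    fix e assume "e \<in> arcs H"
    then obtain i j where e: "e \<in> arcs G" and ij: "i < length Vs" "j < length Vs" "i \<noteq> j"
      "tail G e \<in> Vs ! i" "head G e \<in> Vs ! j"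
      by (auto simp: H B)
    have "e \<in> D \<longleftrightarrow> i < j"
    proof
      assume "e \<in> D"
      then obtain k l where "k < l" "l < length Vs" "tail G e \<in> Vs ! k" "head G e \<in> Vs ! l"
        unfolding D by blast
      moreover from this have "k = i" "l = j"
        using uniq ij by (meson less_trans)+
      ultimately show "i < j" by simp
    qed (use e ij in \<open>auto simp: D\<close>)
    moreover have "arev e \<in> D \<longleftrightarrow> j < i"
    proof
      assume "arev e \<in> D"
      then obtain k l where "k < l" "l < length Vs" "head G e \<in> Vs ! k" "tail G e \<in> Vs ! l"
        unfolding D using e by auto
      moreover from this have "k = j" "l = i"
        using uniq ij by (meson less_trans)+
      ultimately show "j < i" by simp
    qed (use e ij in \<open>auto simp: D\<close>)
    ultimately show "e \<in> D \<longleftrightarrow> arev e \<notin> D" using ij by auto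
  qed
  ultimately show ?thesis by blast
qed

end

theory Submission
  imports Defs
begin

text \<open>
  Identify the Voronoi cell with the orthogonal projection of the cube \<open>[-1/2, 1/2]\<close> in the space
  of all 1-cochains onto the cut space. One inclusion is \<open>\<bar>n\<bar> \<le> n\<^sup>2\<close> for integers \<open>n\<close>; for the other,
  every \<open>f\<close> on the vertices is, up to a constant, a positive combination of indicators of nested
  sets, so that the support inequalities of the projected cube follow from the Voronoi inequalities
  for cuts. The face of a projected cube in direction \<open>y\<close> depends only on the signs of the
  coordinates of \<open>y\<close>, and the sets of positive arcs of elements of the cut space are precisely the
  coherent acyclic orientations.
\<close>

section \<open>Projections of the cube\<close>

text \<open>Twice the support function of \<open>half_cube\<close>: the maximum of
  \<open>2 * (z \<bullet> y)\<close> over the cube, attained when each nonzero \<open>y $ e\<close>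
  is met by \<open>z $ e\<close> of absolute value 1/2 and equal sign.\<close>

definition l1_norm :: "real ^ 'b \<Rightarrow> real" where
  "l1_norm y = (\<Sum>e\<in>UNIV. \<bar>y $ e\<bar>)"

definition half_cube :: "(real ^ 'b) set" where
  "half_cube = {z. \<forall>e. \<bar>z $ e\<bar> \<le> 1/2}"

text \<open>For a subspace \<open>F\<close> this is the orthogonal projection of the cube onto
  \<open>F\<close>, phrased without a projection map: \<open>x\<close> is the projection of
  \<open>z\<close> when both have the same inner products with \<open>F\<close>.\<close>

definition cube_shadow :: "(real ^ 'b) set \<Rightarrow> (real ^ 'b) set" where
  "cube_shadow F = {x \<in> F. \<exists>z\<in>half_cube. \<forall>y\<in>F. x \<bullet> y = z \<bullet> y}"

text \<open>For \<open>y\<close> in \<open>F\<close>, the set where the functional \<open>y\<close>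
  attains its maximum \<open>l1_norm y / 2\<close> on the shadow; \<open>y = 0\<close> gives the
  whole shadow.\<close>

definition shadow_face :: "(real ^ 'b) set \<Rightarrow> real ^ 'b \<Rightarrow> (real ^ 'b) set" where
  "shadow_face F y = {x \<in> cube_shadow F. 2 * (x \<bullet> y) = l1_norm y}"

lemma orthogonal_projection_exists:
  fixes S :: "'v::euclidean_space set"
  assumes "subspace S"
  obtains p where "linear p" "range p \<subseteq> S" "\<And>z y. y \<in> S \<Longrightarrow> p z \<bullet> y = z \<bullet> y"
proof -
  obtain B where B: "B \<subseteq> S" "pairwise orthogonal B" "\<And>x. x \<in> B \<Longrightarrow> norm x = 1"
      "independent B" "span B = S"
    using orthonormal_basis_subspace[OF assms] by metis
  have fin: "finite B" by (rule independent_imp_finite[OF B(4)])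
  define p where "p z = (\<Sum>b\<in>B. (z \<bullet> b) *\<^sub>R b)" for z
  show thesis
  proof
    show "linear p"
      unfolding p_def
      by (auto intro!: linearI
          simp: inner_add_left scaleR_add_left sum.distrib scaleR_sum_right)
    show "range p \<subseteq> S"
      using B(1) assms by (auto simp: p_def intro!: subspace_sum subspace_scale)
    fix z y assume "y \<in> S"
    have base: "p z \<bullet> c = z \<bullet> c" if c: "c \<in> B" for c
    proof -
      have "p z \<bullet> c = (\<Sum>b\<in>B. if b = c then z \<bullet> c else 0)"
        unfolding p_def inner_sum_left
        using B(2,3) c
        by (intro sum.cong) (auto simp: pairwise_def orthogonal_def norm_eq_1)
      then show ?thesis using fin c by simp
    qed
    have "(p z - z) \<bullet> y = 0"
      using \<open>y \<in> S\<close>[folded B(5)]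
      by (induction rule: span_induct_alt) (auto simp: inner_diff_left inner_add_right base)
    then show "p z \<bullet> y = z \<bullet> y" by (simp add: inner_diff_left)
  qed
qed

lemma half_cube_eq_cbox: "half_cube = cbox (\<chi> e. - (1/2)) (\<chi> e. 1/2)"
  by (auto simp: half_cube_def mem_box_cart abs_le_iff
      simp del: divide_le_eq_numeral1 le_divide_eq_numeral1)
    (smt (verit) field_sum_of_halves)+

lemma polytope_half_cube: "polytope half_cube"
  by (simp add: half_cube_eq_cbox polytope_interval)

lemma half_cube_coord_le:
  assumes "z \<in> half_cube"
  shows "2 * (z $ e * y $ e) \<le> \<bar>y $ e\<bar>"
proof -
  have "\<bar>z $ e\<bar> * \<bar>y $ e\<bar> \<le> 1/2 * \<bar>y $ e\<bar>"
    using assms by (intro mult_right_mono) (auto simp: half_cube_def)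
  then show ?thesis
    using abs_ge_self[of "z $ e * y $ e"] by (simp add: abs_mult)
qed

lemma half_cube_inner_le: "z \<in> half_cube \<Longrightarrow> 2 * (z \<bullet> y) \<le> l1_norm y"
  by (auto simp: inner_vec_def l1_norm_def sum_distrib_left intro!: sum_mono half_cube_coord_le)

text \<open>The gap in \<open>half_cube_inner_le\<close> is a sum of nonnegative terms, one per
  coordinate, so it vanishes only if every term does.\<close>

lemma half_cube_inner_eq_iff:
  assumes "z \<in> half_cube"
  shows "2 * (z \<bullet> y) = l1_norm y \<longleftrightarrow> (\<forall>e. 2 * (z $ e * y $ e) = \<bar>y $ e\<bar>)"
proof -
  have "2 * (z \<bullet> y) = l1_norm y \<longleftrightarrow> (\<Sum>e\<in>UNIV. \<bar>y $ e\<bar> - 2 * (z $ e * y $ e)) = 0"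
    by (auto simp: inner_vec_def l1_norm_def sum_distrib_left sum_subtractf)
  also have "\<dots> \<longleftrightarrow> (\<forall>e. \<bar>y $ e\<bar> - 2 * (z $ e * y $ e) = 0)"
    using half_cube_coord_le[OF assms] by (subst sum_nonneg_eq_0_iff) auto
  finally show ?thesis by auto
qed

lemma half_sgn_in_half_cube: "(\<chi> e. sgn (y $ e) / 2) \<in> half_cube"
  by (auto simp: half_cube_def sgn_if)

lemma cube_shadow_eq_projection:
  assumes "range p \<subseteq> F" "\<And>z y. y \<in> F \<Longrightarrow> p z \<bullet> y = z \<bullet> y" "subspace F"
  shows "cube_shadow F = p ` half_cube"
proof (intro equalityI subsetI)
  fix x assume "x \<in> cube_shadow F"
  then obtain z where x: "x \<in> F" and z: "z \<in> half_cube" "\<And>y. y \<in> F \<Longrightarrow> x \<bullet> y = z \<bullet> y"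
    by (auto simp: cube_shadow_def)
  \<comment> \<open>The difference lies in \<open>F\<close> and is orthogonal to \<open>F\<close>,
    hence to itself.\<close>
  have "x - p z \<in> F" using x assms by (auto intro: subspace_diff)
  then have "(x - p z) \<bullet> (x - p z) = 0"
    using z(2) assms(2) by (simp add: inner_diff_left)
  then show "x \<in> p ` half_cube" using z by auto
qed (use assms in \<open>auto simp: cube_shadow_def\<close>)

lemma polytope_cube_shadow:
  assumes "subspace F"
  shows "polytope (cube_shadow F)"
proof -
  obtain p where "linear p" "range p \<subseteq> F" "\<And>z y. y \<in> F \<Longrightarrow> p z \<bullet> y = z \<bullet> y"
    using orthogonal_projection_exists[OF assms] by metis
  then show ?thesis
    by (simp add: cube_shadow_eq_projection[OF _ _ assms] polytope_linear_image
        polytope_half_cube)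
qed

lemma cube_shadow_inner_le:
  assumes "x \<in> cube_shadow F" "y \<in> F"
  shows "2 * (x \<bullet> y) \<le> l1_norm y"
proof -
  obtain z where z: "z \<in> half_cube" "x \<bullet> y = z \<bullet> y"
    using assms by (auto simp: cube_shadow_def)
  show ?thesis unfolding z(2) by (rule half_cube_inner_le[OF z(1)])
qed

text \<open>The vector \<open>sgn (y $ e) / 2\<close> is the centre of the face of the cube that is
  maximal in direction \<open>y\<close>. Its projection serves below as a maximizer over the shadow
  for \<open>y\<close> in \<open>F\<close>, and as the test point that tells the faces
  apart.\<close>

lemma shadow_face_sgn_vertex:
  assumes "subspace F"
  obtains x where "x \<in> cube_shadow F"
    "\<And>y'. y' \<in> F \<Longrightarrow> x \<bullet> y' = (\<chi> e. sgn (y $ e) / 2) \<bullet> y'"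
proof -
  obtain p where p: "range p \<subseteq> F" "\<And>z y. y \<in> F \<Longrightarrow> p z \<bullet> y = z \<bullet> y"
    using orthogonal_projection_exists[OF assms] by metis
  show thesis
  proof (rule that)
    show "p (\<chi> e. sgn (y $ e) / 2) \<in> cube_shadow F"
      using cube_shadow_eq_projection[of p F] p assms half_sgn_in_half_cube by blast
  qed (rule p(2))
qed

lemma half_sgn_inner_eq: "2 * ((\<chi> e. sgn (y $ e) / 2) \<bullet> y) = l1_norm y"
  by (subst half_cube_inner_eq_iff[OF half_sgn_in_half_cube]) (auto simp: sgn_if)

text \<open>A closed convex set is the intersection of its supporting half-spaces. Inside
  \<open>F\<close> only directions from \<open>F\<close> matter, and there \<open>l1_norm\<close> is
  twice the support function of the shadow.\<close>

lemma mem_cube_shadow_iff: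
  assumes F: "subspace F"
  shows "x \<in> cube_shadow F \<longleftrightarrow> x \<in> F \<and> (\<forall>y\<in>F. 2 * (x \<bullet> y) \<le> l1_norm y)"
proof (intro iffI conjI)
  assume "x \<in> F \<and> (\<forall>y\<in>F. 2 * (x \<bullet> y) \<le> l1_norm y)"
  then have x: "x \<in> F" and le: "\<And>y. y \<in> F \<Longrightarrow> 2 * (x \<bullet> y) \<le> l1_norm y" by auto
  obtain p where p: "range p \<subseteq> F" "\<And>z y. y \<in> F \<Longrightarrow> p z \<bullet> y = z \<bullet> y"
    using orthogonal_projection_exists[OF F] by metis
  show "x \<in> cube_shadow F"
  proof (rule ccontr)
    assume nx: "x \<notin> cube_shadow F"
    have "convex (cube_shadow F)" "closed (cube_shadow F)"
      using polytope_cube_shadow[OF F]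
      by (auto intro: polytope_imp_convex polytope_imp_closed)
    from separating_hyperplane_closed_point[OF this nx]
    obtain a b where ab: "a \<bullet> x < b" "\<And>w. w \<in> cube_shadow F \<Longrightarrow> a \<bullet> w > b"
      by auto
    \<comment> \<open>Projecting the normal \<open>a\<close> to \<open>F\<close> keeps its values on
      \<open>F\<close>. The sign is reversed because the shadow lies on the larger side of the
      hyperplane; in direction \<open>y\<close>, the point \<open>x\<close> then exceeds even the
      maximizer \<open>w\<close>.\<close>
    define y where "y = - p a"
    have y: "y \<in> F" using p(1) F by (auto simp: y_def intro: subspace_neg)
    have ay: "w \<bullet> y = - (a \<bullet> w)" if "w \<in> F" for w
      using p(2)[OF that] by (simp add: y_def inner_commute)
    obtain w where w: "w \<in> cube_shadow F" "\<And>y'. y' \<in> F \<Longrightarrow> w \<bullet> y' = (\<chi> e. sgn (y $ e) / 2) \<bullet> y'"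
      using shadow_face_sgn_vertex[OF F] by blast
    have "2 * (w \<bullet> y) = l1_norm y" using w(2)[OF y] half_sgn_inner_eq by simp
    moreover have "w \<in> F" using w(1) by (simp add: cube_shadow_def)
    ultimately show False using le[OF y] ay[OF x] ay[of w] ab(1) ab(2)[OF w(1)] by linarith
  qed
next
  show "x \<in> F" if "x \<in> cube_shadow F" using that by (simp add: cube_shadow_def)
  show "\<forall>y\<in>F. 2 * (x \<bullet> y) \<le> l1_norm y" if "x \<in> cube_shadow F"
    using that by (blast intro: cube_shadow_inner_le)
qed

section \<open>Faces of the shadow and sign patterns\<close>

lemma shadow_face_nonempty:
  assumes "subspace F" "y \<in> F"
  shows "shadow_face F y \<noteq> {}"
proof -
  obtain x where "x \<in> cube_shadow F" "\<And>y'. y' \<in> F \<Longrightarrow> x \<bullet> y' = (\<chi> e. sgn (y $ e) / 2) \<bullet> y'"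
    using shadow_face_sgn_vertex[OF assms(1)] by blast
  then have "x \<in> shadow_face F y"
    using assms(2) half_sgn_inner_eq by (simp add: shadow_face_def)
  then show ?thesis by auto
qed

text \<open>A point of the shadow lies in the face of \<open>y\<close> iff a cube point
  \<open>z\<close> above it satisfies \<open>z $ e = sgn (y $ e) / 2\<close> wherever
  \<open>y $ e\<close> is nonzero. One face contains another when its constraints are among those of
  the other.\<close>

lemma shadow_face_subset_iff:
  assumes F: "subspace F" and y: "y1 \<in> F" "y2 \<in> F"
  shows "shadow_face F y1 \<subseteq> shadow_face F y2 \<longleftrightarrow>
    (\<forall>e. y2 $ e \<noteq> 0 \<longrightarrow> sgn (y1 $ e) = sgn (y2 $ e))"
proof
  assume sub: "shadow_face F y1 \<subseteq> shadow_face F y2"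
  obtain x where x: "x \<in> cube_shadow F"
      "\<And>y'. y' \<in> F \<Longrightarrow> x \<bullet> y' = (\<chi> e. sgn (y1 $ e) / 2) \<bullet> y'"
    using shadow_face_sgn_vertex[OF F] by blast
  then have "x \<in> shadow_face F y1"
    using y half_sgn_inner_eq by (simp add: shadow_face_def)
  \<comment> \<open>One test point suffices for this direction: where \<open>y1\<close> vanishes its
    cube coordinate is 0, which forces \<open>y2\<close> to vanish there as well.\<close>
  then have "2 * ((\<chi> e. sgn (y1 $ e) / 2) \<bullet> y2) = l1_norm y2"
    using sub x(2)[OF y(2)] by (auto simp: shadow_face_def)
  then have "\<forall>e. sgn (y1 $ e) * y2 $ e = \<bar>y2 $ e\<bar>"
    by (subst (asm) half_cube_inner_eq_iff[OF half_sgn_in_half_cube]) simp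
  then show "\<forall>e. y2 $ e \<noteq> 0 \<longrightarrow> sgn (y1 $ e) = sgn (y2 $ e)"
    by (metis abs_sgn mult.commute mult_cancel_left)
next
  assume sg: "\<forall>e. y2 $ e \<noteq> 0 \<longrightarrow> sgn (y1 $ e) = sgn (y2 $ e)"
  show "shadow_face F y1 \<subseteq> shadow_face F y2"
  proof
    fix x assume x: "x \<in> shadow_face F y1"
    then obtain z where z: "z \<in> half_cube" "\<And>y. y \<in> F \<Longrightarrow> x \<bullet> y = z \<bullet> y"
      by (auto simp: shadow_face_def cube_shadow_def)
    have "2 * (z \<bullet> y1) = l1_norm y1" using x z(2) y by (simp add: shadow_face_def)
    then have z1: "2 * (z $ e * y1 $ e) = \<bar>y1 $ e\<bar>" for e
      by (simp add: half_cube_inner_eq_iff[OF z(1)])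
    have "2 * (z $ e * y2 $ e) = \<bar>y2 $ e\<bar>" for e
    proof (cases "y2 $ e = 0")
      case False
      with sg have s: "sgn (y1 $ e) = sgn (y2 $ e)" by blast
      then have "y1 $ e \<noteq> 0" using False by (auto simp: sgn_zero_iff)
      then have "2 * z $ e = sgn (y1 $ e)"
        using z1[of e] by (metis abs_sgn mult.assoc mult.commute mult_cancel_left)
      then show ?thesis using s by (metis abs_sgn mult.assoc mult.commute)
    qed simp
    then have "2 * (z \<bullet> y2) = l1_norm y2" by (simp add: half_cube_inner_eq_iff[OF z(1)])
    then show "x \<in> shadow_face F y2"
      using x z(2)[OF y(2)] by (simp add: shadow_face_def)
  qed
qed

text \<open>Faces of a polytope are exposed, and the normal of an exposing hyperplane can be
  replaced by its projection to \<open>F\<close>.\<close>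

lemma faces_cube_shadow:
  assumes F: "subspace F"
  shows "faces (cube_shadow F) = shadow_face F ` F"
proof (intro equalityI subsetI)
  fix T assume "T \<in> faces (cube_shadow F)"
  then have T: "T face_of cube_shadow F" "T \<noteq> {}" by (auto simp: faces_def)
  then have "T exposed_face_of cube_shadow F"
    by (simp add: exposed_face_of_polyhedron polytope_imp_polyhedron polytope_cube_shadow[OF F])
  then obtain a b where ab: "cube_shadow F \<subseteq> {x. a \<bullet> x \<le> b}" "T = cube_shadow F \<inter> {x. a \<bullet> x = b}"
    by (auto simp: exposed_face_of_def)
  obtain p where p: "range p \<subseteq> F" "\<And>z y. y \<in> F \<Longrightarrow> p z \<bullet> y = z \<bullet> y"
    using orthogonal_projection_exists[OF F] by metis
  have y: "p a \<in> F" using p(1) by auto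
  have ay: "x \<bullet> p a = a \<bullet> x" if "x \<in> cube_shadow F" for x
    using p(2)[of x a] that by (auto simp: cube_shadow_def inner_commute)
  \<comment> \<open>Since \<open>T\<close> is nonempty, \<open>b\<close> is the maximum of the
    functional on the shadow, which is half of \<open>l1_norm (p a)\<close>.\<close>
  have "l1_norm (p a) = 2 * b"
  proof (rule antisym)
    obtain w where "w \<in> shadow_face F (p a)" using shadow_face_nonempty[OF F y] by auto
    then show "l1_norm (p a) \<le> 2 * b" using ab(1) ay by (auto simp: shadow_face_def)
    obtain x where "x \<in> T" using T by auto
    then show "2 * b \<le> l1_norm (p a)"
      using ab(2) ay[of x] cube_shadow_inner_le[of x F "p a"] y by auto
  qed
  then have "T = shadow_face F (p a)" using ab(2) ay by (auto simp: shadow_face_def)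
  then show "T \<in> shadow_face F ` F" using y by auto
next
  fix T assume "T \<in> shadow_face F ` F"
  then obtain y where y: "y \<in> F" "T = shadow_face F y" by auto
  have "T = cube_shadow F \<inter> {x. y \<bullet> x = l1_norm y / 2}"
    unfolding y(2) shadow_face_def by (auto simp: inner_commute)
  moreover have "cube_shadow F \<inter> {x. y \<bullet> x = l1_norm y / 2} face_of cube_shadow F"
  proof (rule face_of_Int_supporting_hyperplane_le)
    show "convex (cube_shadow F)" by (rule polytope_imp_convex[OF polytope_cube_shadow[OF F]])
    show "\<And>x. x \<in> cube_shadow F \<Longrightarrow> y \<bullet> x \<le> l1_norm y / 2"
      using cube_shadow_inner_le[OF _ y(1)] by (fastforce simp: inner_commute)
  qed
  ultimately show "T \<in> faces (cube_shadow F)"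
    using shadow_face_nonempty[OF F y(1)] y(2) by (simp add: faces_def)
qed

section \<open>The Voronoi cell of the cut lattice\<close>

text \<open>Members of \<open>C0\<close> are extensional functions on \<open>verts G\<close>. As
  arcs have both ends in \<open>verts G\<close>, potentials defined on the whole type may be used in
  their place.\<close>

lemma coboundary_restrict:
  assumes "wf_digraph G"
  shows "coboundary G (restrict f (verts G)) = coboundary G f"
proof -
  interpret wf_digraph G by (rule assms)
  show ?thesis by (auto simp: coboundary_def vec_eq_iff)
qed

lemma cut_space_eq_range:
  assumes "wf_digraph G"
  shows "cut_space G = range (coboundary G)"
proof -
  have "coboundary G f \<in> cut_space G" for f
    unfolding cut_space_def
    by (rule image_eqI[of _ _ "restrict f (verts G)"])
      (auto simp: coboundary_restrict[OF assms] C0_def)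
  then show ?thesis by (auto simp: cut_space_def)
qed

lemma coboundary_in_cut_lattice:
  assumes "wf_digraph G" "\<And>v. f v \<in> \<int>"
  shows "coboundary G f \<in> cut_lattice G"
  unfolding cut_lattice_def
  by (rule image_eqI[of _ _ "restrict f (verts G)"])
    (auto simp: coboundary_restrict[OF assms(1)] C0_def assms(2))

lemma subspace_cut_space:
  assumes "wf_digraph G"
  shows "subspace (cut_space G)"
proof -
  note range = cut_space_eq_range[OF assms]
  have zero: "coboundary G (\<lambda>v. 0) = 0"
    and add: "coboundary G f + coboundary G g = coboundary G (\<lambda>v. f v + g v)"
    and scale: "c *\<^sub>R coboundary G f = coboundary G (\<lambda>v. c * f v)" for f g c
    by (auto simp: coboundary_def vec_eq_iff algebra_simps)
  show ?thesis
  proof (rule subspaceI)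
    show "0 \<in> cut_space G" unfolding range zero[symmetric] by (rule rangeI)
  qed (auto simp: range add scale)
qed

text \<open>Grouping the arcs into edges gives pairs \<open>{e, rv e}\<close> of distinct arcs,
  whose two summands agree because both signs flip.\<close>

lemma inner_eq_twice_edge_inner:
  fixes G :: "('a, 'b::finite) pre_digraph"
  assumes G: "bidirected_digraph G rv" and x: "x \<in> C1 G rv UNIV" and y: "y \<in> C1 G rv UNIV"
  shows "x \<bullet> y = 2 * edge_inner G rv x y"
proof -
  interpret bidirected_digraph G rv by (rule G)
  have "x \<bullet> y = (\<Sum>e\<in>arcs G. x $ e * y $ e)"
    using x by (auto simp: inner_vec_def C1_def intro!: sum.mono_neutral_right)
  also have "arcs G = \<Union>(edges G rv)" by (auto simp: edges_def)
  also have "(\<Sum>e\<in>\<Union>(edges G rv). x $ e * y $ e) = (\<Sum>p\<in>edges G rv. \<Sum>e\<in>p. x $ e * y $ e)"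
    by (subst sum.Union_disjoint) (auto simp: edges_def arev_eq_iff)
  also have "\<dots> = (\<Sum>p\<in>edges G rv. 2 * (let e = (SOME e. e \<in> p) in x $ e * y $ e))"
  proof (rule sum.cong[OF refl])
    fix p assume "p \<in> edges G rv"
    then obtain e where e: "e \<in> arcs G" "p = {e, rv e}" by (auto simp: edges_def)
    have "(SOME a. a \<in> p) \<in> p" by (rule someI[of _ e]) (simp add: e)
    then show "(\<Sum>e\<in>p. x $ e * y $ e) = 2 * (let e = (SOME e. e \<in> p) in x $ e * y $ e)"
      using x y e arev_neq[OF e(1)] by (auto simp: Let_def C1_def)
  qed
  finally show ?thesis by (simp add: edge_inner_def sum_distrib_left)
qed

text \<open>Expand the square of \<open>x - a\<close>; the factor 2 between the two inner products
  occurs on both sides and cancels.\<close>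

lemma edge_norm_le_iff:
  fixes G :: "('a, 'b::finite) pre_digraph"
  assumes G: "bidirected_digraph G rv" and x: "x \<in> cut_space G" and a: "a \<in> cut_space G"
  shows "edge_norm G rv x \<le> edge_norm G rv (x - a) \<longleftrightarrow> 2 * (x \<bullet> a) \<le> a \<bullet> a"
proof -
  interpret bidirected_digraph G rv by (rule G)
  have C: "w \<in> C1 G rv UNIV" if "w \<in> cut_space G" for w
    using that coboundary_in_C1[OF G] by (auto simp: cut_space_def)
  have "x - a \<in> cut_space G"
    using subspace_cut_space[OF wf_digraph_axioms] x a by (rule subspace_diff)
  then have "edge_norm G rv x \<le> edge_norm G rv (x - a) \<longleftrightarrow> x \<bullet> x \<le> (x - a) \<bullet> (x - a)"
    using inner_eq_twice_edge_inner[OF G C C] x by (simp add: edge_norm_def)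
  then show ?thesis by (simp add: inner_diff_left inner_diff_right inner_commute)
qed

section \<open>Voronoi inequalities against support inequalities\<close>

lemma l1_norm_le_inner_self:
  assumes "\<And>e. a $ e \<in> \<int>"
  shows "l1_norm a \<le> a \<bullet> a"
proof -
  have "\<bar>r\<bar> \<le> r * r" if r: "r \<in> \<int>" for r :: real
  proof -
    obtain k where k: "r = of_int k" using r by (rule Ints_cases)
    have "\<bar>k\<bar> * 1 \<le> \<bar>k\<bar> * \<bar>k\<bar>" by (cases "k = 0") (auto simp del: abs_mult_self_eq)
    then have "\<bar>k\<bar> \<le> k * k" by simp
    then have "real_of_int \<bar>k\<bar> \<le> real_of_int (k * k)" by (rule of_int_le_iff[THEN iffD2])
    then show ?thesis unfolding k by simp
  qed
  then show ?thesis by (auto simp: l1_norm_def inner_vec_def assms intro!: sum_mono)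
qed

text \<open>Induction on the number of values of \<open>f\<close>, peeling off the top level set.
  The left side is linear in \<open>f\<close>, and \<open>l1_norm\<close> is additive along this
  decomposition, so the inequalities for cuts add up.\<close>

lemma inner_coboundary_le_l1_norm:
  fixes G :: "('a, 'b::finite) pre_digraph"
  assumes G: "fin_digraph G"
    and cuts: "\<And>S. 2 * (x \<bullet> coboundary G (indicator S)) \<le> l1_norm (coboundary G (indicator S))"
  shows "2 * (x \<bullet> coboundary G f) \<le> l1_norm (coboundary G f)"
proof (induction "card (f ` verts G)" arbitrary: f rule: less_induct)
  case less
  interpret fin_digraph G by (rule G)
  show ?case
  proof (cases "\<exists>c. \<forall>v\<in>verts G. f v = c")
    case True
    then have "coboundary G f = 0" by (auto simp: coboundary_def vec_eq_iff)
    then show ?thesis by (simp add: l1_norm_def)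
  next
    case False
    define A where "A = f ` verts G"
    define M where "M = Max A"
    have fA: "finite A" by (simp add: A_def)
    have "verts G \<noteq> {}" using False by auto
    then have "A \<noteq> {}" by (simp add: A_def)
    then have M: "M \<in> A" "\<And>a. a \<in> A \<Longrightarrow> a \<le> M" using fA by (auto simp: M_def)
    have ne: "A - {M} \<noteq> {}"
      using False unfolding A_def by (metis DiffI empty_iff imageI singletonD)
    define m where "m = Max (A - {M})"
    have m: "m \<in> A" "m \<noteq> M" "\<And>a. a \<in> A \<Longrightarrow> a \<noteq> M \<Longrightarrow> a \<le> m"
      using Max_in[OF _ ne] fA by (auto simp: m_def)
    then have mM: "m < M" using M(2)[of m] by simp
    define g where "g v = min (f v) m" for v
    have val: "f v = M \<or> f v \<le> m" if "v \<in> verts G" for v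
      using m(3)[of "f v"] that by (auto simp: A_def)
    define S where "S = {v. f v = M}"
    have "g ` verts G \<subseteq> A - {M}"
    proof
      fix a assume "a \<in> g ` verts G"
      then obtain v where v: "v \<in> verts G" "a = g v" by auto
      show "a \<in> A - {M}"
        using val[OF v(1)] v mM m(1) by (auto simp: g_def A_def min_def)
    qed
    then have "card (g ` verts G) < card (f ` verts G)"
      using M(1) fA unfolding A_def by (intro psubset_card_mono) auto
    note IH = less[OF this]
    \<comment> \<open>On no arc do the coboundaries of \<open>g\<close> and of the indicator have
      opposite signs, since \<open>g\<close> is maximal on \<open>S\<close>. Hence the absolute
      values add without cancellation.\<close>
    have arc: "coboundary G f $ e = coboundary G g $ e + (M - m) * coboundary G (indicator S) $ e"
        "\<bar>coboundary G f $ e\<bar> = \<bar>coboundary G g $ e\<bar> + (M - m) * \<bar>coboundary G (indicator S) $ e\<bar>" for e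
      using val[of "tail G e"] val[of "head G e"] mM
      by (auto simp: coboundary_def g_def S_def min_def indicator_def)
    have "coboundary G f = coboundary G g + (M - m) *\<^sub>R coboundary G (indicator S)"
      using arc(1) by (simp add: vec_eq_iff)
    then have "2 * (x \<bullet> coboundary G f) =
        2 * (x \<bullet> coboundary G g) + (M - m) * (2 * (x \<bullet> coboundary G (indicator S)))"
      by (simp only: inner_add_right inner_scaleR_right distrib_left mult.left_commute)
    also have "\<dots> \<le> l1_norm (coboundary G g) + (M - m) * l1_norm (coboundary G (indicator S))"
      using IH cuts mM by (intro add_mono mult_left_mono) auto
    also have "\<dots> = l1_norm (coboundary G f)"
      by (simp add: l1_norm_def arc(2) sum.distrib sum_distrib_left)
    finally show ?thesis .
  qed
qed

lemma voronoi_cell_eq_cube_shadow: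
  fixes G :: "('a, 'b::finite) pre_digraph"
  assumes G: "bidirected_digraph G rv" and fin: "fin_digraph G"
  shows "voronoi_cell G rv = cube_shadow (cut_space G)"
proof -
  interpret bidirected_digraph G rv by (rule G)
  note wf = wf_digraph_axioms
  have lat: "cut_lattice G \<subseteq> cut_space G"
    unfolding cut_lattice_def cut_space_eq_range[OF wf] by auto
  have V: "x \<in> voronoi_cell G rv \<longleftrightarrow>
      x \<in> cut_space G \<and> (\<forall>a\<in>cut_lattice G. 2 * (x \<bullet> a) \<le> a \<bullet> a)" for x
    using lat edge_norm_le_iff[OF G] by (auto simp: voronoi_cell_def)
  have l1: "2 * (x \<bullet> y) \<le> l1_norm y"
    if "\<forall>a\<in>cut_lattice G. 2 * (x \<bullet> a) \<le> a \<bullet> a" "y \<in> cut_space G" for x y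
  proof -
    have "2 * (x \<bullet> coboundary G (indicator S)) \<le> l1_norm (coboundary G (indicator S))" for S
    proof -
      have "coboundary G (indicator S) \<in> cut_lattice G"
        by (rule coboundary_in_cut_lattice[OF wf]) (auto simp: indicator_def)
      \<comment> \<open>The coordinates are -1, 0 or 1, so squares equal absolute values: for cuts
        the Voronoi inequality is exactly the support inequality.\<close>
      moreover have "coboundary G (indicator S) \<bullet> coboundary G (indicator S)
          = l1_norm (coboundary G (indicator S))"
        by (auto simp: inner_vec_def l1_norm_def coboundary_def indicator_def intro!: sum.cong)
      ultimately show ?thesis using that(1) by fastforce
    qed
    then show ?thesis
      using inner_coboundary_le_l1_norm[OF fin] that(2) by (auto simp: cut_space_def)
  qed
  have lattice: "2 * (x \<bullet> a) \<le> a \<bullet> a"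
    if "\<forall>y\<in>cut_space G. 2 * (x \<bullet> y) \<le> l1_norm y" "a \<in> cut_lattice G" for x a
  proof -
    have "a $ e \<in> \<int>" for e
      using that(2) coboundary_in_C1_Ints[OF G]
      by (cases "e \<in> arcs G") (auto simp: cut_lattice_def C1_def)
    then have "l1_norm a \<le> a \<bullet> a" by (rule l1_norm_le_inner_self)
    then show ?thesis using that lat by fastforce
  qed
  show ?thesis
  proof (rule set_eqI)
    show "x \<in> voronoi_cell G rv \<longleftrightarrow> x \<in> cube_shadow (cut_space G)" for x
      unfolding V mem_cube_shadow_iff[OF subspace_cut_space[OF wf]] using l1 lattice by blast
  qed
qed

section \<open>Coherent acyclic orientations\<close>

text \<open>For \<open>y = coboundary G f\<close> these are the arcs along which the potential
  \<open>f\<close> strictly increases.\<close>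

definition positive_arcs :: "('a, 'b::finite) pre_digraph \<Rightarrow> real ^ 'b \<Rightarrow> 'b set" where
  "positive_arcs G y = {e \<in> arcs G. y $ e > 0}"

text \<open>Ordered partitions correspond to potentials: the index of a part is a potential, and
  conversely the level sets of a potential are ordered by their values.\<close>

lemma coherent_acyclic_iff_positive_arcs:
  fixes G :: "('a, 'b::finite) pre_digraph"
  assumes "fin_digraph G"
  shows "coherent_acyclic G D \<longleftrightarrow> (\<exists>y\<in>cut_space G. D = positive_arcs G y)"
proof
  interpret fin_digraph G by (rule assms)
  assume "coherent_acyclic G D"
  then obtain Vs where d: "distinct Vs" and p: "partition_on (verts G) (set Vs)"
    and D: "D = {e \<in> arcs G. \<exists>i j. i < j \<and> j < length Vs \<and> tail G e \<in> Vs ! i \<and> head G e \<in> Vs ! j}"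
    by (auto simp: coherent_acyclic_def)
  \<comment> \<open>The potential is the index of the part containing \<open>v\<close>; disjointness
    makes it well defined on \<open>verts G\<close>.\<close>
  define h where "h v = (THE i. i < length Vs \<and> v \<in> Vs ! i)" for v
  have uniq: "i = j" if "v \<in> Vs ! i" "v \<in> Vs ! j" "i < length Vs" "j < length Vs" for v i j
  proof -
    have "Vs ! i = Vs ! j"
      using that p nth_mem[of i Vs] nth_mem[of j Vs]
      unfolding partition_on_def disjoint_def by blast
    then show ?thesis using d that by (simp add: nth_eq_iff_index_eq)
  qed
  have h_eq: "h v = i" if "v \<in> Vs ! i" "i < length Vs" for v i
    unfolding h_def by (rule the_equality) (use that uniq in blast)+
  have h: "h v < length Vs \<and> v \<in> Vs ! h v" if v: "v \<in> verts G" for v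
  proof -
    obtain i where "i < length Vs" "v \<in> Vs ! i"
      using v p unfolding partition_on_def by (metis UnionE in_set_conv_nth)
    then show ?thesis using h_eq by blast
  qed
  have "(\<exists>i j. i < j \<and> j < length Vs \<and> tail G e \<in> Vs ! i \<and> head G e \<in> Vs ! j) \<longleftrightarrow>
      h (tail G e) < h (head G e)" if e: "e \<in> arcs G" for e
  proof
    assume "\<exists>i j. i < j \<and> j < length Vs \<and> tail G e \<in> Vs ! i \<and> head G e \<in> Vs ! j"
    then obtain i j where "i < j" "j < length Vs" "tail G e \<in> Vs ! i" "head G e \<in> Vs ! j" by blast
    then show "h (tail G e) < h (head G e)" using h_eq[of "tail G e" i] h_eq[of "head G e" j] by simp
  next
    assume "h (tail G e) < h (head G e)"
    then show "\<exists>i j. i < j \<and> j < length Vs \<and> tail G e \<in> Vs ! i \<and> head G e \<in> Vs ! j"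
      using h[of "tail G e"] h[of "head G e"] e by auto
  qed
  then have "D = positive_arcs G (coboundary G (\<lambda>v. real (h v)))"
    unfolding D by (auto simp: positive_arcs_def coboundary_def)
  then show "\<exists>y\<in>cut_space G. D = positive_arcs G y"
    by (auto simp: cut_space_eq_range[OF wf_digraph_axioms])
next
  interpret fin_digraph G by (rule assms)
  assume "\<exists>y\<in>cut_space G. D = positive_arcs G y"
  then obtain f where D: "D = positive_arcs G (coboundary G f)" by (auto simp: cut_space_def)
  \<comment> \<open>Only attained values are listed, so that every level set is a nonempty part;
    sorting puts the parts in order of increasing potential.\<close>
  define cs where "cs = sorted_list_of_set (f ` verts G)"
  have cs: "set cs = f ` verts G" "distinct cs" "sorted_wrt (<) cs"
    by (simp_all add: cs_def)
  define L where "L c = {v \<in> verts G. f v = c}" for c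
  define Vs where "Vs = map L cs"
  have "inj_on L (set cs)" by (auto simp: inj_on_def L_def cs)
  then have "distinct Vs" by (simp add: Vs_def distinct_map cs)
  moreover have "partition_on (verts G) (set Vs)"
    by (auto simp: partition_on_def disjoint_def Vs_def cs L_def)
  moreover have "f (tail G e) < f (head G e) \<longleftrightarrow>
      (\<exists>i j. i < j \<and> j < length Vs \<and> tail G e \<in> Vs ! i \<and> head G e \<in> Vs ! j)"
    if e: "e \<in> arcs G" for e
  proof
    assume lt: "f (tail G e) < f (head G e)"
    obtain i j where ij: "i < length cs" "j < length cs" "cs ! i = f (tail G e)" "cs ! j = f (head G e)"
      using e cs(1) by (metis head_in_verts tail_in_verts imageI in_set_conv_nth)
    have "i < j"
    proof (rule ccontr)
      assume "\<not> i < j"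
      then have "j = i \<or> cs ! j < cs ! i"
        using sorted_wrt_nth_less[OF cs(3), of j i] ij by linarith
      then show False using ij lt by auto
    qed
    then show "\<exists>i j. i < j \<and> j < length Vs \<and> tail G e \<in> Vs ! i \<and> head G e \<in> Vs ! j"
      using ij e by (intro exI[of _ i] exI[of _ j]) (auto simp: Vs_def L_def)
  next
    assume "\<exists>i j. i < j \<and> j < length Vs \<and> tail G e \<in> Vs ! i \<and> head G e \<in> Vs ! j"
    then obtain i j where "i < j" "j < length cs" "tail G e \<in> L (cs ! i)" "head G e \<in> L (cs ! j)"
      by (auto simp: Vs_def)
    then show "f (tail G e) < f (head G e)"
      using cs(3) by (auto simp: L_def sorted_wrt_iff_nth_less)
  qed
  then have "D = {e \<in> arcs G. \<exists>i j. i < j \<and> j < length Vs \<and> tail G e \<in> Vs ! i \<and> head G e \<in> Vs ! j}"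
    unfolding D positive_arcs_def coboundary_def by auto
  ultimately show "coherent_acyclic G D" unfolding coherent_acyclic_def by blast
qed

lemma CAC_eq_positive_arcs:
  fixes G :: "('a, 'b::finite) pre_digraph"
  assumes G: "bidirected_digraph G rv" and fin: "fin_digraph G"
  shows "CAC G rv = positive_arcs G ` cut_space G"
  using bidirected_digraph.coherent_acyclic_orients_cut_subgraph[OF G]
    coherent_acyclic_iff_positive_arcs[OF fin]
  by (auto simp: CAC_def)

text \<open>By antisymmetry \<open>y $ e\<close> is negative on an arc \<open>e\<close> exactly when
  \<open>rv e\<close> is a positive arc, so the positive arcs determine all signs. The condition
  obtained is the one of \<open>shadow_face_subset_iff\<close>.\<close>

lemma positive_arcs_subset_iff:
  fixes G :: "('a, 'b::finite) pre_digraph"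
  assumes G: "bidirected_digraph G rv" and y: "y1 \<in> C1 G rv UNIV" "y2 \<in> C1 G rv UNIV"
  shows "positive_arcs G y2 \<subseteq> positive_arcs G y1 \<longleftrightarrow>
    (\<forall>e. y2 $ e \<noteq> 0 \<longrightarrow> sgn (y1 $ e) = sgn (y2 $ e))"
proof
  interpret bidirected_digraph G rv by (rule G)
  assume sub: "positive_arcs G y2 \<subseteq> positive_arcs G y1"
  show "\<forall>e. y2 $ e \<noteq> 0 \<longrightarrow> sgn (y1 $ e) = sgn (y2 $ e)"
  proof (intro allI impI)
    fix e assume "y2 $ e \<noteq> 0"
    moreover from this have e: "e \<in> arcs G" using y by (auto simp: C1_def)
    moreover have "y1 $ rv e = - y1 $ e" "y2 $ rv e = - y2 $ e" using y e by (auto simp: C1_def)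
    ultimately show "sgn (y1 $ e) = sgn (y2 $ e)"
      \<comment> \<open>The inclusion is applied to \<open>e\<close> if \<open>y2 $ e\<close> is
        positive and to \<open>rv e\<close> if it is negative.\<close>
      using subsetD[OF sub, of e] subsetD[OF sub, of "rv e"]
      by (cases "y2 $ e > 0") (auto simp: positive_arcs_def)
  qed
next
  assume "\<forall>e. y2 $ e \<noteq> 0 \<longrightarrow> sgn (y1 $ e) = sgn (y2 $ e)"
  then show "positive_arcs G y2 \<subseteq> positive_arcs G y1"
    by (fastforce simp: positive_arcs_def sgn_if split: if_splits)
qed

section \<open>The isomorphism of posets\<close>

text \<open>Both families induce the same preorder on the index set \<open>Y\<close>, with inclusion
  reversed for \<open>g\<close>. They therefore identify the same indices, and \<open>f y\<close>
  can be sent to \<open>g y\<close>.\<close>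

lemma poset_isomorphic_images:
  assumes iff: "\<And>x y. x \<in> Y \<Longrightarrow> y \<in> Y \<Longrightarrow> f x \<subseteq> f y \<longleftrightarrow> g y \<subseteq> g x"
  shows "poset_isomorphic (f ` Y) (\<subseteq>) (g ` Y) (\<lambda>A B. B \<subseteq> A)"
proof -
  \<comment> \<open>An arbitrary index of \<open>A\<close> is chosen; two indices with equal
    \<open>f\<close> have equal \<open>g\<close> by \<open>iff\<close> in both directions.\<close>
  define \<phi> where "\<phi> A = g (inv_into Y f A)" for A
  have \<phi>: "\<phi> (f y) = g y" if "y \<in> Y" for y
  proof -
    have "inv_into Y f (f y) \<in> Y" "f (inv_into Y f (f y)) = f y"
      using that by (simp_all add: inv_into_into f_inv_into_f)
    then show ?thesis using iff that unfolding \<phi>_def by blast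
  qed
  have inj: "f x = f y" if "x \<in> Y" "y \<in> Y" "g x = g y" for x y
  proof (rule subset_antisym)
    show "f x \<subseteq> f y" "f y \<subseteq> f x"
      using iff[OF that(1,2)] iff[OF that(2,1)] that(3) by simp_all
  qed
  have "inj_on \<phi> (f ` Y)"
  proof (intro inj_onI; elim imageE; hypsubst)
    show "f x = f y" if "x \<in> Y" "y \<in> Y" "\<phi> (f x) = \<phi> (f y)" for x y
      using inj[OF that(1,2)] that(3) unfolding \<phi>[OF that(1)] \<phi>[OF that(2)] .
  qed
  moreover have "\<phi> ` f ` Y = g ` Y" unfolding image_image using \<phi> by (rule image_cong[OF refl])
  ultimately have "bij_betw \<phi> (f ` Y) (g ` Y)" by (simp add: bij_betw_def)
  moreover have "f x \<subseteq> f y \<longleftrightarrow> \<phi> (f y) \<subseteq> \<phi> (f x)" if "x \<in> Y" "y \<in> Y" for x y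
    unfolding \<phi>[OF that(1)] \<phi>[OF that(2)] by (rule iff[OF that])
  ultimately show ?thesis
    unfolding poset_isomorphic_def by blast
qed

theorem theorem3p19:
  fixes G :: "('a, 'b::finite) pre_digraph" and rv :: "'b \<Rightarrow> 'b"
  assumes "bidirected_digraph G rv"
    and "fin_digraph G"
    and "loopfree_digraph G"
    and "Digraph_Component.connected G"
  shows "poset_isomorphic (faces (voronoi_cell G rv)) (\<subseteq>) (CAC G rv) CAC_le"
proof -
  have sub: "subspace (cut_space G)"
    using assms(2) by (intro subspace_cut_space) (simp add: fin_digraph_def)
  have C: "y \<in> C1 G rv UNIV" if "y \<in> cut_space G" for y
    using that coboundary_in_C1[OF assms(1)] by (auto simp: cut_space_def)
  \<comment> \<open>Both inclusions amount to the same condition: the signs of \<open>x\<close> and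
    \<open>y\<close> agree wherever \<open>y\<close> is nonzero.\<close>
  have "shadow_face (cut_space G) x \<subseteq> shadow_face (cut_space G) y \<longleftrightarrow>
      positive_arcs G y \<subseteq> positive_arcs G x" if "x \<in> cut_space G" "y \<in> cut_space G" for x y
    using shadow_face_subset_iff[OF sub that]
      positive_arcs_subset_iff[OF assms(1) C[OF that(1)] C[OF that(2)]] by simp
  moreover have le: "CAC_le = (\<lambda>D E. E \<subseteq> D)" by (auto simp: CAC_le_def fun_eq_iff)
  ultimately show ?thesis
    unfolding le voronoi_cell_eq_cube_shadow[OF assms(1,2)] faces_cube_shadow[OF sub]
      CAC_eq_positive_arcs[OF assms(1,2)]
    by (intro poset_isomorphic_images)
qed

end
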